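(* For every instance $(E,Q,\hat c,\delta,\Gamma)$ of a multi-objective cardinality-constrained uncertain combinatorial optimization problem with objective independent element order, the improved algorithm DSA-oi (with the reduced index set and with solution checking, as described in the context) finds a complete set of robust efficient solutions, and it solves at most $\left\lceil\frac{|E|-\Gamma_1}{2}\right\rceil+1$ deterministic subproblems $\mathcal{MP}(l)$.
   Context: Vectors: for $y^1,y^2\in\mathbb R^k$, $y^1$ dominates $y^2$ if $y^1_i\le y^2_i$ for all $i$ and $y^1\ne y^2$. For a multi-objective problem $\min_{x\in X}f(x)$ with $f:X\to\mathbb R^k$, $x'$ dominates $x$ if $f(x')$ dominates $f(x)$; $x\in X$ is efficient if no $x'\in X$ dominates it; two efficient solutions $x,x'$ are equivalent if $f(x)=f(x')$; a set $\bar X\subseteq X$ of efficient solutions is complete if every $x\in X\setminus\bar X$ is dominated by or equivalent to some $x'\in\bar X$. Instance: $E$ is a finite set, $Q\subseteq 2^E$ the set of feasible solutions, $k\ge2$ the number of objectives; for $e\in E$, $i\in\{1,\dots,k\}$ there are a nominal cost $\hat c_{e,i}\in\mathbb R$ and an interval length $\delta_{e,i}\ge0$; $\Gamma=(\Gamma_1,\dots,\Gamma_k)$ with integers $0\le\Gamma_i\le|E|$. The uncertainty set is $$\mathcal U=\{c\in\mathbb R^{|E|\times k}: c_{e,i}\in[\hat c_{e,i},\hat c_{e,i}+\delta_{e,i}]\ \forall e,i;\ |\{e: c_{e,i}>\hat c_{e,i}\}|\le\Gamma_i\ \forall i\}.$$ For $q\in Q$, $z^R(q)=(z^R_1(q),\dots,z^R_k(q))$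 with $z^R_i(q)=\max_{c\in\mathcal U}\sum_{e\in q}c_{e,i}$. Robust efficient means efficient for $\min_{q\in Q}z^R(q)$; a complete set of robust efficient solutions is a complete set of efficient solutions for this problem. The instance has objective independent element order if $\Gamma_1=\dots=\Gamma_k$ and there is an order $e_1,\dots,e_{|E|}$ of the elements with $\delta_{e_1,i}\ge\dots\ge\delta_{e_{|E|},i}$ for all $i$. Fix such an order and put $\delta_e=(\delta_{e,i})_i$, $\hat c_e=(\hat c_{e,i})_i$, $\bar\delta_j:=\delta_{e_j}$ for $j\le|E|$ and $\bar\delta_{|E|+1}:=(0,\dots,0)$. For $l\in\{1,\dots,|E|+1\}$, $\mathcal{MP}(l)$ is the problem $\min_{q\in Q} g^l(q):=\sum_{e\in q}\hat c_e+\Gamma\circ\bar\delta_l+\sum_{e_j\in q,\ j\le l}(\delta_{e_j}-\bar\delta_l)$, where $\circ$ is the entry-wise product. Improved DSA-oi: (1) Reduced index set $L$: start with $l:=\Gamma_1+1$ and $L:=\{l\}$. While $l<|E|+1$ repeat: (i) while $l<|E|+1$ and $\bar\delta_l=\bar\delta_{l+1}$, set $l:=l+1$; (ii) if $l<|E|+1$, then set $l:=l+1$, after that, if still $l<|E|+1$, set $l:=l+1$ once more, and then add $l$ to $L$. (2) Solving with solution checking: process the $l\in L$ in increasing order. For the first $l$, solve $\mathcal{MP}(l)$, i.e. compute some complete set of efficient solutions $OPT^l$ of it. For each later $l$, let $\tilde l$ be the preceding element of $L$: if some set in $OPT^{\tilde l}$ contains an element of $\{e_1,\dots,e_{l-1}\}$,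 solve $\mathcal{MP}(l)$ to obtain a complete set of efficient solutions $OPT^l$; otherwise set $OPT^l:=OPT^{\tilde l}$ without solving a subproblem. (3) Output all $q\in A:=\bigcup_{l\in L}OPT^l$ for which no $q'\in A$ has $z^R(q')$ dominating $z^R(q)$. *)

theory Defs
  imports "HOL-Analysis.Analysis" "HOL-Library.While_Combinator"
begin

definition dominates :: "real^'k \<Rightarrow> real^'k \<Rightarrow> bool" where
  "dominates y1 y2 \<longleftrightarrow> (\<forall>i. y1 $ i \<le> y2 $ i) \<and> y1 \<noteq> y2"

definition efficient :: "'x set \<Rightarrow> ('x \<Rightarrow> real^'k) \<Rightarrow> 'x \<Rightarrow> bool" where
  "efficient X f x \<longleftrightarrow> x \<in> X \<and> \<not> (\<exists>x'\<in>X. dominates (f x') (f x))"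

definition complete_efficient_set ::
    "'x set \<Rightarrow> ('x \<Rightarrow> real^'k) \<Rightarrow> 'x set \<Rightarrow> bool" where
  "complete_efficient_set X f Y \<longleftrightarrow>
     (\<forall>y\<in>Y. efficient X f y) \<and>
     (\<forall>x\<in>X - Y. \<exists>x'\<in>Y. dominates (f x') (f x) \<or> f x' = f x)"

record ('e, 'k) uncertain_instance =
  ground :: "'e set"
  feasible :: "'e set set"
  nominal :: "'e \<Rightarrow> real^'k"
  deviation :: "'e \<Rightarrow> real^'k"
  budget :: "nat^'k"

definition valid_instance :: "('e, 'k::finite) uncertain_instance \<Rightarrow> bool" where
  "valid_instance I \<longleftrightarrow>
     finite (ground I) \<and>
     feasible I \<subseteq> Pow (ground I) \<and>
     CARD('k) \<ge> 2 \<and>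
     (\<forall>e\<in>ground I. \<forall>i. 0 \<le> deviation I e $ i) \<and>
     (\<forall>i. budget I $ i \<le> card (ground I))"

definition uncertainty_set :: "('e, 'k::finite) uncertain_instance \<Rightarrow> ('e \<Rightarrow> real^'k) set" where
  "uncertainty_set I =
     {c \<in> ground I \<rightarrow>\<^sub>E UNIV.
        (\<forall>e\<in>ground I. \<forall>i. c e $ i \<in> {nominal I e $ i .. nominal I e $ i + deviation I e $ i}) \<and>
        (\<forall>i. card {e \<in> ground I. c e $ i > nominal I e $ i} \<le> budget I $ i)}"

text \<open>The maximum over the (in general infinite) uncertainty set is attained in every valid
  instance, the set being a nonempty finite union of boxes.\<close>

definition robust_cost :: "('e, 'k::finite) uncertain_instance \<Rightarrow> 'e set \<Rightarrow> real^'k" where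
  "robust_cost I q =
     (\<chi> i. GREATEST v. \<exists>c\<in>uncertainty_set I. v = (\<Sum>e\<in>q. c e $ i))"

text \<open>The elements are numbered from 1, as \<open>ord 1, \<dots>, ord (card (ground I))\<close>.\<close>

definition objective_independent_order ::
    "('e, 'k::finite) uncertain_instance \<Rightarrow> (nat \<Rightarrow> 'e) \<Rightarrow> bool" where
  "objective_independent_order I ord \<longleftrightarrow>
     (\<forall>i i'. budget I $ i = budget I $ i') \<and>
     bij_betw ord {1..card (ground I)} (ground I) \<and>
     (\<forall>i. \<forall>j\<in>{1..<card (ground I)}. deviation I (ord j) $ i \<ge> deviation I (ord (j + 1)) $ i)"

definition sorted_deviation ::
    "('e, 'k::finite) uncertain_instance \<Rightarrow> (nat \<Rightarrow> 'e) \<Rightarrow> nat \<Rightarrow> real^'k" where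
  "sorted_deviation I ord l =
     (if l \<le> card (ground I) then deviation I (ord l) else 0)"

definition subproblem_cost ::
    "('e, 'k::finite) uncertain_instance \<Rightarrow> (nat \<Rightarrow> 'e) \<Rightarrow> nat \<Rightarrow> 'e set \<Rightarrow> real^'k" where
  "subproblem_cost I ord l q =
     (\<Sum>e\<in>q. nominal I e)
     + (\<chi> i. real (budget I $ i) * sorted_deviation I ord l $ i)
     + (\<Sum>j | j \<in> {1..card (ground I)} \<and> ord j \<in> q \<and> j \<le> l.
          deviation I (ord j) - sorted_deviation I ord l)"

text \<open>The index \<open>i1\<close> is the objective whose budget initializes the index set.
  The loop state consists of the current index and the indices collected so far.\<close>

definition skip_equal ::
    "('e, 'k::finite) uncertain_instance \<Rightarrow> (nat \<Rightarrow> 'e) \<Rightarrow> nat \<Rightarrow> nat" where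
  "skip_equal I ord =
     while (\<lambda>l. l < card (ground I) + 1 \<and>
                sorted_deviation I ord l = sorted_deviation I ord (l + 1))
           (\<lambda>l. l + 1)"

definition index_step ::
    "('e, 'k::finite) uncertain_instance \<Rightarrow> (nat \<Rightarrow> 'e) \<Rightarrow> nat \<times> nat set \<Rightarrow> nat \<times> nat set" where
  "index_step I ord = (\<lambda>(l, L).
     let N = card (ground I) + 1; l' = skip_equal I ord l in
       if l' < N
       then let l'' = (if l' + 1 < N then l' + 2 else l' + 1) in (l'', insert l'' L)
       else (l', L))"

definition reduced_index_set ::
    "('e, 'k::finite) uncertain_instance \<Rightarrow> 'k \<Rightarrow> (nat \<Rightarrow> 'e) \<Rightarrow> nat set" where
  "reduced_index_set I i1 ord =
     snd (while (\<lambda>(l, L). l < card (ground I) + 1) (index_step I ord)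
            (budget I $ i1 + 1, {budget I $ i1 + 1}))"

definition must_solve :: "(nat \<Rightarrow> 'e) \<Rightarrow> 'e set set option \<Rightarrow> nat \<Rightarrow> bool" where
  "must_solve ord prev l \<longleftrightarrow>
     (case prev of None \<Rightarrow> True | Some P \<Rightarrow> \<exists>q\<in>P. q \<inter> ord ` {1..l - 1} \<noteq> {})"

text \<open>\<open>solve_phase I ord prev ls A n\<close>: processing the list \<open>ls\<close> of remaining indices, where
  \<open>prev\<close> is the solution set of the preceding index (if any), may yield solution sets with
  union \<open>A\<close> while solving \<open>n\<close> subproblems. It is a relation because any complete set may be
  returned for a subproblem.\<close>

inductive solve_phase ::
    "('e, 'k::finite) uncertain_instance \<Rightarrow> (nat \<Rightarrow> 'e) \<Rightarrow>
     'e set set option \<Rightarrow> nat list \<Rightarrow> 'e set set \<Rightarrow> nat \<Rightarrow> bool"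
  for I ord where
  finished: "solve_phase I ord prev [] {} 0"
| solved: "solve_phase I ord prev (l # ls) (OPT \<union> A) (n + 1)"
    if "must_solve ord prev l"
      and "complete_efficient_set (feasible I) (subproblem_cost I ord l) OPT"
      and "solve_phase I ord (Some OPT) ls A n"
| reused: "solve_phase I ord (Some OPT) (l # ls) (OPT \<union> A) n"
    if "\<not> must_solve ord (Some OPT) l"
      and "solve_phase I ord (Some OPT) ls A n"

definition improved_DSA_oi ::
    "('e, 'k::finite) uncertain_instance \<Rightarrow> 'k \<Rightarrow> (nat \<Rightarrow> 'e) \<Rightarrow> 'e set set \<Rightarrow> nat \<Rightarrow> bool" where
  "improved_DSA_oi I i1 ord result n \<longleftrightarrow>
     (\<exists>A. solve_phase I ord None (sorted_list_of_set (reduced_index_set I i1 ord)) A n \<and>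
          result = {q \<in> A. \<not> (\<exists>q'\<in>A. dominates (robust_cost I q') (robust_cost I q))})"

end

theory Submission
  imports Defs
begin

text \<open>Write \<open>\<delta> l\<close> for the deviation of the \<open>l\<close>-th element and \<open>\<Gamma>\<close> for the common budget. Since
  the deviations are sorted, the sum over \<open>j \<le> l\<close> in the cost of \<open>MP(l)\<close> is a sum of positive parts:
  \<open>g l q = (\<Sum>e\<in>q. c\<^sub>e) + \<Gamma> \<delta> l + (\<Sum>e\<in>q. max 0 (\<delta>\<^sub>e - \<delta> l))\<close>.
  This form is the dual bound for the adversary who raises at most \<open>\<Gamma>\<close> costs: it bounds the robust cost
  of \<open>q\<close> from above for every \<open>l\<close> (\<open>robust_cost_le_subproblem_cost\<close>), and it is equal to the robust
  cost, in all objectives at once, when \<open>\<delta> l\<close> separates the \<open>\<Gamma>\<close> largest deviations in \<open>q\<close> from the others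
  (\<open>exact_if_deviation_between\<close>), or when \<open>q\<close> has at most \<open>\<Gamma>\<close> elements and \<open>\<delta> l = 0\<close>.

  If \<open>m\<close> is an index such that exactly \<open>\<Gamma>\<close> elements of \<open>q\<close> are among the first \<open>m\<close>, then both \<open>\<delta> m\<close> and
  \<open>\<delta> (m + 1)\<close> separate in this sense. So an index set need only contain, up to equality of deviations,
  one of any two consecutive indices, which is what the reduced index set guarantees while growing
  by one index per two positions; this also gives the bound on the number of subproblems.

  Skipping a subproblem is harmless: if all solutions found for an index \<open>p < l\<close> avoid the first \<open>l - 1\<close>
  elements, their cost in \<open>MP(p)\<close> and \<open>MP(l)\<close> is just the nominal cost plus a constant, while for any
  other solution the positive parts only grow from \<open>p\<close> to \<open>l\<close> (\<open>weakly_covers_if_avoids\<close>).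

  Hence the union \<open>A\<close> of the solution sets contains, for every feasible \<open>q\<close> and an index \<open>l\<close> at which \<open>q\<close> is
  exact, some \<open>q'\<close> with \<open>z q' \<le> g l q' \<le> g l q = z q\<close>, where \<open>z\<close> is the robust cost. Filtering a finite set
  with this property leaves a complete set of efficient solutions.\<close>

section \<open>Complete sets and weak covers\<close>

lemma dominates_iff_less: "dominates y1 y2 \<longleftrightarrow> y1 < y2"
  by (auto simp: dominates_def less_eq_vec_def order_less_le)

lemma ex_minimal_below:
  fixes f :: "'x \<Rightarrow> 'y::order"
  assumes "finite A" and "x \<in> A"
  shows "\<exists>y\<in>A. f y \<le> f x \<and> \<not> (\<exists>y'\<in>A. f y' < f y)"
  using finite_has_minimal2[of "f ` A" "f x"] assms
  by (fastforce simp: order_less_le)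

text \<open>This is completeness without the demand that the chosen solutions be efficient. A solution set that
  is reused for another index may lose efficiency, but not this property.\<close>

definition weakly_covers :: "'x set \<Rightarrow> ('x \<Rightarrow> real^'k) \<Rightarrow> 'x set \<Rightarrow> bool" where
  "weakly_covers X f Y \<longleftrightarrow> Y \<subseteq> X \<and> (\<forall>x\<in>X. \<exists>y\<in>Y. f y \<le> f x)"

lemma complete_efficient_set_imp_weakly_covers:
  assumes "complete_efficient_set X f Y"
  shows "weakly_covers X f Y"
  unfolding weakly_covers_def
proof (intro conjI ballI)
  show "Y \<subseteq> X"
    using assms by (auto simp: complete_efficient_set_def efficient_def)
next
  fix x assume "x \<in> X"
  show "\<exists>y\<in>Y. f y \<le> f x"
  proof (cases "x \<in> Y")
    case False
    with \<open>x \<in> X\<close> assms obtain y where "y \<in> Y" and fy: "f y < f x \<or> f y = f x"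
      unfolding complete_efficient_set_def dominates_iff_less by blast
    from fy have "f y \<le> f x" unfolding order_le_less .
    with \<open>y \<in> Y\<close> show ?thesis ..
  qed auto
qed

text \<open>A feasible solution dominating a member of \<open>A\<close> would be matched by a member of \<open>A\<close> that dominates
  it too, so being nondominated within \<open>A\<close> is the same as being efficient. By finiteness there is a
  nondominated member below each one.\<close>

lemma complete_efficient_set_nondominated:
  assumes "finite X" and cov: "weakly_covers X f A"
  shows "complete_efficient_set X f {q \<in> A. \<not> (\<exists>q'\<in>A. dominates (f q') (f q))}"
    (is "complete_efficient_set X f ?R")
  unfolding complete_efficient_set_def
proof (intro conjI ballI)
  have "A \<subseteq> X" using cov by (simp add: weakly_covers_def)
  fix y assume y: "y \<in> ?R"
  have "\<not> f x < f y" if "x \<in> X" for x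
    using y cov that unfolding weakly_covers_def dominates_iff_less
    by (blast dest: le_less_trans)
  with y \<open>A \<subseteq> X\<close> show "efficient X f y"
    by (auto simp: efficient_def dominates_iff_less)
next
  fix x assume "x \<in> X - ?R"
  with cov obtain a where "a \<in> A" "f a \<le> f x"
    unfolding weakly_covers_def by blast
  moreover have "finite A"
    using cov \<open>finite X\<close> by (auto simp: weakly_covers_def intro: finite_subset)
  ultimately obtain y where "y \<in> ?R" "f y \<le> f x"
    using ex_minimal_below[of A a f] unfolding dominates_iff_less
    by (blast intro: order_trans)
  then show "\<exists>y\<in>?R. dominates (f y) (f x) \<or> f y = f x"
    by (auto simp: dominates_iff_less order_le_less)
qed

lemma ex_complete_efficient_set:
  assumes "finite X"
  shows "\<exists>Y. complete_efficient_set X f Y"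
  using complete_efficient_set_nondominated[OF assms, of f X] by (auto simp: weakly_covers_def)

text \<open>A discrete intermediate value theorem: the count grows by at most one per step.\<close>

lemma ex_initial_segment_card:
  fixes J :: "nat set"
  assumes "k \<le> card (J \<inter> {1..n})"
  shows "\<exists>m\<le>n. card (J \<inter> {1..m}) = k"
  using assms
proof (induction n)
  case (Suc n)
  have "card (J \<inter> {1..Suc n}) \<le> Suc (card (J \<inter> {1..n}))"
    by (simp add: atLeastAtMostSuc_conv card_insert_if Int_insert_right)
  with Suc.prems consider "k \<le> card (J \<inter> {1..n})" | "card (J \<inter> {1..Suc n}) = k"
    by linarith
  then show ?case
  proof cases
    case 1
    with Suc.IH show ?thesis using le_SucI by blast
  qed blast
qed auto

section \<open>Subproblem costs and robust costs\<close>

locale ordered_instance =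
  fixes I :: "('e, 'k::finite) uncertain_instance"
    and ord :: "nat \<Rightarrow> 'e"
    and i1 :: 'k
  assumes valid: "valid_instance I"
    and order: "objective_independent_order I ord"
begin

abbreviation "n \<equiv> card (ground I)"
abbreviation "\<Gamma> \<equiv> budget I $ i1"
abbreviation "\<delta> \<equiv> sorted_deviation I ord"
abbreviation "g \<equiv> subproblem_cost I ord"

lemma finite_ground: "finite (ground I)"
  using valid by (simp add: valid_instance_def)

lemma feasible_subset: "q \<in> feasible I \<Longrightarrow> q \<subseteq> ground I"
  using valid by (auto simp: valid_instance_def)

lemma finite_feasible: "finite (feasible I)"
  using valid by (auto simp: valid_instance_def intro: finite_subset)

lemma finite_solution: "q \<in> feasible I \<Longrightarrow> finite q"
  using feasible_subset finite_ground finite_subset by blast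

lemma budget_eq: "budget I $ i = \<Gamma>"
  using order unfolding objective_independent_order_def by blast

lemma budget_le: "\<Gamma> \<le> n"
  using valid by (simp add: valid_instance_def)

lemma bij_ord: "bij_betw ord {1..n} (ground I)"
  using order unfolding objective_independent_order_def by blast

lemma deviation_nonneg: "e \<in> ground I \<Longrightarrow> 0 \<le> deviation I e $ i"
  using valid by (auto simp: valid_instance_def)

lemma sorted_deviation_nonneg: "1 \<le> l \<Longrightarrow> 0 \<le> \<delta> l $ i"
  using deviation_nonneg bij_betwE[OF bij_ord] by (auto simp: sorted_deviation_def)

lemma sorted_deviation_antimono:
  assumes "1 \<le> j" and "j \<le> k"
  shows "\<delta> k $ i \<le> \<delta> j $ i"
  using assms(2)
proof (induction k rule: dec_induct)
  case (step k)
  have "\<delta> (Suc k) $ i \<le> \<delta> k $ i"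
  proof (cases "Suc k \<le> n")
    case True
    then have "k \<in> {1..<n}" using step assms(1) by auto
    then have "deviation I (ord (k + 1)) $ i \<le> deviation I (ord k) $ i"
      using order unfolding objective_independent_order_def by blast
    with True show ?thesis by (simp add: sorted_deviation_def)
  next
    case False
    then show ?thesis
      using sorted_deviation_nonneg[of k i] step assms(1) by (auto simp: sorted_deviation_def)
  qed
  with step show ?case by linarith
qed simp

definition indices :: "'e set \<Rightarrow> nat set" where
  "indices q = {j \<in> {1..n}. ord j \<in> q}"

lemma bij_indices:
  assumes "q \<subseteq> ground I"
  shows "bij_betw ord (indices q) q"
proof (rule bij_betw_imageI)
  show "inj_on ord (indices q)"
    using bij_betw_imp_inj_on[OF bij_ord] by (rule inj_on_subset) (auto simp: indices_def)
  have "e \<in> ord ` indices q" if "e \<in> q" for e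
  proof -
    from that assms have "e \<in> ord ` {1..n}"
      using bij_betw_imp_surj_on[OF bij_ord] by blast
    with that show ?thesis by (auto simp: indices_def)
  qed
  then show "ord ` indices q = q" by (auto simp: indices_def)
qed

lemma finite_indices [simp]: "finite (indices q)"
  by (simp add: indices_def)

lemma sum_indices:
  fixes f :: "'e \<Rightarrow> real"
  shows "q \<subseteq> ground I \<Longrightarrow> (\<Sum>j\<in>indices q. f (ord j)) = (\<Sum>e\<in>q. f e)"
  using bij_indices sum.reindex_bij_betw by blast

text \<open>Terms with \<open>j > l\<close> contribute nothing to the positive parts because the deviations are sorted. In
  this form the cost depends on \<open>l\<close> only through \<open>\<delta> l\<close>, so indices with equal deviations are
  interchangeable.\<close>

lemma subproblem_cost_pos_part:
  assumes "1 \<le> l"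
  shows "g l q $ i = (\<Sum>e\<in>q. nominal I e $ i) + real \<Gamma> * \<delta> l $ i
           + (\<Sum>j\<in>indices q. max 0 (\<delta> j $ i - \<delta> l $ i))"
proof -
  have "(\<Sum>j | j \<in> {1..n} \<and> ord j \<in> q \<and> j \<le> l. deviation I (ord j) $ i - \<delta> l $ i)
      = (\<Sum>j\<in>indices q. max 0 (\<delta> j $ i - \<delta> l $ i))"
  proof (rule sum.mono_neutral_cong_left)
    show "\<forall>j\<in>indices q - {j. j \<in> {1..n} \<and> ord j \<in> q \<and> j \<le> l}. max 0 (\<delta> j $ i - \<delta> l $ i) = 0"
    proof
      fix j assume "j \<in> indices q - {j. j \<in> {1..n} \<and> ord j \<in> q \<and> j \<le> l}"
      then have "l \<le> j" by (auto simp: indices_def)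
      from sorted_deviation_antimono[OF assms this, of i]
      show "max 0 (\<delta> j $ i - \<delta> l $ i) = 0" by linarith
    qed
    fix j assume "j \<in> {j. j \<in> {1..n} \<and> ord j \<in> q \<and> j \<le> l}"
    then have j: "1 \<le> j" "j \<le> l" and dev: "deviation I (ord j) = \<delta> j"
      by (auto simp: sorted_deviation_def)
    from sorted_deviation_antimono[OF j, of i]
    show "deviation I (ord j) $ i - \<delta> l $ i = max 0 (\<delta> j $ i - \<delta> l $ i)"
      unfolding dev by linarith
  qed (auto simp: indices_def)
  then show ?thesis
    by (simp add: subproblem_cost_def budget_eq[of i])
qed

text \<open>Each of the at most \<open>\<Gamma>\<close> raised elements \<open>e\<close> contributes at most
  \<open>\<delta>\<^sub>e \<le> \<delta> l + max 0 (\<delta>\<^sub>e - \<delta> l)\<close>.\<close>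

lemma sum_scenario_le_subproblem_cost:
  assumes c: "c \<in> uncertainty_set I" and q: "q \<in> feasible I" and l: "1 \<le> l"
  shows "(\<Sum>e\<in>q. c e $ i) \<le> g l q $ i"
proof -
  note qE = feasible_subset[OF q]
  define S where "S = {e \<in> ground I. c e $ i > nominal I e $ i}"
  have "finite S" "card S \<le> \<Gamma>"
    using c finite_ground by (auto simp: uncertainty_set_def S_def simp flip: budget_eq[of i])
  have fin: "finite q" using q by (rule finite_solution)
  have bounds: "c e $ i \<le> nominal I e $ i + deviation I e $ i" if "e \<in> q" for e
    using c qE that by (auto simp: uncertainty_set_def)
  have "(\<Sum>e\<in>q. c e $ i) \<le> (\<Sum>e\<in>q. nominal I e $ i
          + (if e \<in> S then \<delta> l $ i else 0) + max 0 (deviation I e $ i - \<delta> l $ i))"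
    using bounds qE by (intro sum_mono) (fastforce simp: S_def)
  also have "\<dots> = (\<Sum>e\<in>q. nominal I e $ i) + real (card (q \<inter> S)) * \<delta> l $ i
          + (\<Sum>e\<in>q. max 0 (deviation I e $ i - \<delta> l $ i))"
    using fin by (simp add: sum.distrib sum.inter_restrict[symmetric])
  also have "(\<Sum>e\<in>q. max 0 (deviation I e $ i - \<delta> l $ i))
      = (\<Sum>j\<in>indices q. max 0 (\<delta> j $ i - \<delta> l $ i))"
    using sum_indices[OF qE, of "\<lambda>e. max 0 (deviation I e $ i - \<delta> l $ i)"]
    by (simp add: indices_def sorted_deviation_def)
  also have "real (card (q \<inter> S)) * \<delta> l $ i \<le> real \<Gamma> * \<delta> l $ i"
  proof (rule mult_right_mono[OF _ sorted_deviation_nonneg[OF l]])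
    have "card (q \<inter> S) \<le> card S" using \<open>finite S\<close> by (intro card_mono) auto
    with \<open>card S \<le> \<Gamma>\<close> show "real (card (q \<inter> S)) \<le> real \<Gamma>" by simp
  qed
  finally show ?thesis using l by (simp add: subproblem_cost_pos_part)
qed

text \<open>The set \<open>T\<close> is a set of elements which the adversary can raise to attain the upper bound \<open>g l q\<close>,
  the same set in every objective.\<close>

definition exact :: "'e set \<Rightarrow> nat \<Rightarrow> bool" where
  "exact q l \<longleftrightarrow> 1 \<le> l \<and>
     (\<exists>T\<subseteq>q. card T \<le> \<Gamma> \<and> (\<forall>i. g l q $ i = (\<Sum>e\<in>q. nominal I e $ i) + (\<Sum>e\<in>T. deviation I e $ i)))"

lemma exact_attained:
  assumes q: "q \<in> feasible I" and "exact q l"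
  shows "\<exists>c\<in>uncertainty_set I. \<forall>i. g l q $ i = (\<Sum>e\<in>q. c e $ i)"
proof -
  note qE = feasible_subset[OF q]
  have fin: "finite q" using q by (rule finite_solution)
  obtain T where T: "T \<subseteq> q" "card T \<le> \<Gamma>"
    and gT: "\<And>i. g l q $ i = (\<Sum>e\<in>q. nominal I e $ i) + (\<Sum>e\<in>T. deviation I e $ i)"
    using \<open>exact q l\<close> unfolding exact_def by blast
  define c where "c = (\<lambda>e\<in>ground I. nominal I e + (if e \<in> T then deviation I e else 0))"
  have "card {e \<in> ground I. nominal I e $ i < c e $ i} \<le> budget I $ i" for i
  proof -
    have "{e \<in> ground I. nominal I e $ i < c e $ i} \<subseteq> T"
      by (auto simp: c_def split: if_splits)
    then have "card {e \<in> ground I. nominal I e $ i < c e $ i} \<le> card T"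
      using T fin finite_subset by (intro card_mono) auto
    with T show ?thesis unfolding budget_eq[of i] by simp
  qed
  then have "c \<in> uncertainty_set I"
    using deviation_nonneg unfolding uncertainty_set_def
    by (auto simp: c_def)
  moreover have "(\<Sum>e\<in>q. c e $ i) = g l q $ i" for i
  proof -
    have "(\<Sum>e\<in>q. c e $ i) = (\<Sum>e\<in>q. nominal I e $ i + (if e \<in> T then deviation I e $ i else 0))"
      using qE by (intro sum.cong) (auto simp: c_def)
    also have "\<dots> = g l q $ i"
      using fin T by (simp add: gT sum.distrib sum.inter_restrict[symmetric] Int_absorb1)
    finally show ?thesis .
  qed
  ultimately show ?thesis by metis
qed

lemma robust_cost_exact:
  assumes q: "q \<in> feasible I" and ex: "exact q l"
  shows "robust_cost I q = g l q"
proof -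
  have l: "1 \<le> l" using ex by (simp add: exact_def)
  have "(GREATEST v. \<exists>c\<in>uncertainty_set I. v = (\<Sum>e\<in>q. c e $ i)) = g l q $ i" for i
    using exact_attained[OF q ex] sum_scenario_le_subproblem_cost[OF _ q l]
    by (intro Greatest_equality) auto
  then show ?thesis by (simp add: robust_cost_def vec_eq_iff)
qed

text \<open>Here the adversary raises the whole of \<open>q\<close>.\<close>

lemma exact_if_deviation_zero:
  assumes q: "q \<in> feasible I" and "card q \<le> \<Gamma>" and l: "1 \<le> l" "\<delta> l = 0"
  shows "exact q l"
proof -
  have "(\<Sum>j\<in>indices q. max 0 (\<delta> j $ i)) = (\<Sum>e\<in>q. deviation I e $ i)" for i
    unfolding sum_indices[OF feasible_subset[OF q], symmetric]
    using sorted_deviation_nonneg by (intro sum.cong) (auto simp: indices_def sorted_deviation_def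
      deviation_nonneg bij_betwE[OF bij_ord])
  with assms show ?thesis
    unfolding exact_def by (auto simp: subproblem_cost_pos_part)
qed

text \<open>The adversary raises the \<open>\<Gamma>\<close> elements of \<open>q\<close> among the first \<open>m\<close>. Their positive parts
  are \<open>\<delta>\<^sub>e - \<delta> l\<close>, those of the other elements vanish, and the \<open>\<Gamma>\<close> copies of \<open>\<delta> l\<close> cancel against the constant of the cost. For \<open>\<Gamma> = 0\<close>
  the index \<open>m\<close> may be \<open>0\<close>, a position without an element, so the upper bound on \<open>\<delta> l\<close> is conditional.\<close>

lemma exact_if_deviation_between:
  assumes q: "q \<in> feasible I" and m: "card (indices q \<inter> {1..m}) = \<Gamma>" and l: "1 \<le> l"
    and upper: "\<And>i. 1 \<le> m \<Longrightarrow> \<delta> l $ i \<le> \<delta> m $ i"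
    and lower: "\<And>i. \<delta> (m + 1) $ i \<le> \<delta> l $ i"
  shows "exact q l"
proof -
  define T where "T = indices q \<inter> {1..m}"
  have inj: "inj_on ord T"
    using bij_indices[OF feasible_subset[OF q]] by (auto simp: bij_betw_def T_def intro: inj_on_subset)
  have card_T: "card T = \<Gamma>" using m by (simp add: T_def)
  have "(\<Sum>j\<in>indices q. max 0 (\<delta> j $ i - \<delta> l $ i)) = (\<Sum>j\<in>T. \<delta> j $ i - \<delta> l $ i)" for i
  proof (rule sum.mono_neutral_cong_right)
    show "\<forall>j\<in>indices q - T. max 0 (\<delta> j $ i - \<delta> l $ i) = 0"
    proof
      fix j assume "j \<in> indices q - T"
      then have "m + 1 \<le> j" by (auto simp: T_def indices_def)
      with sorted_deviation_antimono[of "m + 1" j i] lower[of i]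
      show "max 0 (\<delta> j $ i - \<delta> l $ i) = 0" by linarith
    qed
    fix j assume "j \<in> T"
    then have "1 \<le> j" "j \<le> m" by (auto simp: T_def)
    with sorted_deviation_antimono[of j m i] upper[of i]
    show "max 0 (\<delta> j $ i - \<delta> l $ i) = \<delta> j $ i - \<delta> l $ i" by linarith
  qed (auto simp: T_def)
  also have "(\<Sum>j\<in>T. \<delta> j $ i - \<delta> l $ i) = (\<Sum>e\<in>ord ` T. deviation I e $ i) - real \<Gamma> * \<delta> l $ i" for i
    by (simp add: sum_subtractf sum.reindex[OF inj] card_T)
      (simp add: T_def indices_def sorted_deviation_def)
  finally have "g l q $ i = (\<Sum>e\<in>q. nominal I e $ i) + (\<Sum>e\<in>ord ` T. deviation I e $ i)" for i
    using l by (simp add: subproblem_cost_pos_part)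
  moreover have "ord ` T \<subseteq> q" by (auto simp: T_def indices_def)
  moreover have "card (ord ` T) \<le> \<Gamma>" using card_T card_image[OF inj] by simp
  ultimately show ?thesis using l unfolding exact_def by blast
qed

text \<open>By the two previous lemmas, a solution with more than \<open>\<Gamma>\<close> elements is exact at the values \<open>\<delta> m\<close>
  and \<open>\<delta> (m + 1)\<close> for some \<open>m \<ge> \<Gamma>\<close>, and a smaller one at the value \<open>0\<close>. In the case \<open>m = \<Gamma>\<close> the
  first index \<open>\<Gamma> + 1\<close> serves.\<close>

definition hits_every_exact_interval :: "nat set \<Rightarrow> bool" where
  "hits_every_exact_interval L \<longleftrightarrow> L \<subseteq> {1..n + 1} \<and> \<Gamma> + 1 \<in> L \<and>
     (\<exists>k\<in>L. \<delta> k = 0) \<and>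
     (\<forall>m\<in>{\<Gamma> + 1..n}. \<exists>k\<in>L. \<delta> k = \<delta> m \<or> \<delta> k = \<delta> (m + 1))"

lemma ex_exact_index:
  assumes q: "q \<in> feasible I" and L: "hits_every_exact_interval L"
  shows "\<exists>l\<in>L. exact q l"
proof (cases "card q \<le> \<Gamma>")
  case True
  then show ?thesis
    using exact_if_deviation_zero[OF q] L by (fastforce simp: hits_every_exact_interval_def)
next
  case False
  have "card (indices q) = card q"
    using bij_betw_same_card[OF bij_indices[OF feasible_subset[OF q]]] .
  moreover have "indices q \<inter> {1..n} = indices q" by (auto simp: indices_def)
  ultimately obtain m where "m \<le> n" and m: "card (indices q \<inter> {1..m}) = \<Gamma>"
    using ex_initial_segment_card[of \<Gamma> "indices q" n] False by auto
  have "\<Gamma> \<le> m"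
    using card_mono[of "{1..m}" "indices q \<inter> {1..m}"] m by simp
  then consider "m = \<Gamma>" | "\<Gamma> + 1 \<le> m" by linarith
  then have "\<exists>k\<in>L. (1 \<le> m \<and> \<delta> k = \<delta> m) \<or> \<delta> k = \<delta> (m + 1)"
  proof cases
    case 1
    then show ?thesis using L by (auto simp: hits_every_exact_interval_def)
  next
    case 2
    with \<open>m \<le> n\<close> have "m \<in> {\<Gamma> + 1..n}" by simp
    with L have "\<exists>k\<in>L. \<delta> k = \<delta> m \<or> \<delta> k = \<delta> (m + 1)"
      unfolding hits_every_exact_interval_def by blast
    with 2 show ?thesis by auto
  qed
  then obtain k where "k \<in> L" "(1 \<le> m \<and> \<delta> k = \<delta> m) \<or> \<delta> k = \<delta> (m + 1)"
    by blast
  then have "exact q k"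
    using L sorted_deviation_antimono[of m "m + 1"]
    by (intro exact_if_deviation_between[OF q m]) (auto simp: hits_every_exact_interval_def)
  with \<open>k \<in> L\<close> show ?thesis by blast
qed

text \<open>An exact index, which exists already in the full index set, is needed to know that the maximum
  defining the robust cost is attained by a scenario.\<close>

lemma robust_cost_le_subproblem_cost:
  assumes q: "q \<in> feasible I" and l: "1 \<le> l"
  shows "robust_cost I q \<le> g l q"
proof -
  have "hits_every_exact_interval {1..n + 1}"
    unfolding hits_every_exact_interval_def
  proof (intro conjI ballI)
    show "\<exists>k\<in>{1..n + 1}. \<delta> k = 0"
      by (rule bexI[of _ "n + 1"]) (auto simp: sorted_deviation_def)
    fix m assume "m \<in> {\<Gamma> + 1..n}"
    then show "\<exists>k\<in>{1..n + 1}. \<delta> k = \<delta> m \<or> \<delta> k = \<delta> (m + 1)"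
      by (intro bexI[of _ m]) auto
  qed (use budget_le in auto)
  then obtain k where "exact q k" using ex_exact_index[OF q] by blast
  then show ?thesis
    using exact_attained[OF q] sum_scenario_le_subproblem_cost[OF _ q l] robust_cost_exact[OF q]
    by (fastforce simp: less_eq_vec_def)
qed

section \<open>Solution checking\<close>

text \<open>Solutions \<open>q'\<close> in \<open>P\<close> only use elements from position \<open>l\<close> on, so their positive parts vanish for \<open>p\<close>
  and for \<open>l\<close>. The constant \<open>\<Gamma> \<delta> p\<close> cancels in the comparison of \<open>q'\<close> with \<open>q\<close>, and replacing
  \<open>\<delta> p\<close> by the smaller \<open>\<delta> l\<close> only increases the positive parts of \<open>q\<close>.\<close>

lemma weakly_covers_if_avoids:
  assumes P: "weakly_covers (feasible I) (g p) P"
    and p: "1 \<le> p" "p < l"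
    and avoid: "\<not> must_solve ord (Some P) l"
  shows "weakly_covers (feasible I) (g l) P"
  unfolding weakly_covers_def
proof (intro conjI ballI)
  show "P \<subseteq> feasible I" using P by (simp add: weakly_covers_def)
  fix q assume "q \<in> feasible I"
  with P obtain q' where "q' \<in> P" and le: "g p q' \<le> g p q"
    unfolding weakly_covers_def by blast
  have above: "l \<le> j" if "j \<in> indices q'" for j
    using avoid \<open>q' \<in> P\<close> that
    by (rule_tac ccontr) (fastforce simp: must_solve_def indices_def)
  have small: "(\<Sum>j\<in>indices q'. max 0 (\<delta> j $ i - \<delta> k $ i)) = 0" if "1 \<le> k" "k \<le> l" for i k
  proof (intro sum.neutral ballI)
    fix j assume "j \<in> indices q'"
    then have "k \<le> j" using above that by force
    from sorted_deviation_antimono[OF \<open>1 \<le> k\<close> this, of i]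
    show "max 0 (\<delta> j $ i - \<delta> k $ i) = 0" by linarith
  qed
  have "g l q' $ i \<le> g l q $ i" for i
  proof -
    have "(\<Sum>j\<in>indices q. max 0 (\<delta> j $ i - \<delta> p $ i))
        \<le> (\<Sum>j\<in>indices q. max 0 (\<delta> j $ i - \<delta> l $ i))"
      using sorted_deviation_antimono[of p l i] p by (intro sum_mono) auto
    moreover have "g p q' $ i \<le> g p q $ i" using le by (simp add: less_eq_vec_def)
    ultimately show ?thesis
      using p small[of p i] small[of l i] by (simp add: subproblem_cost_pos_part)
  qed
  with \<open>q' \<in> P\<close> show "\<exists>y\<in>P. g l y \<le> g l q"
    by (auto simp: less_eq_vec_def)
qed

section \<open>The reduced index set\<close>

lemma skip_equal_spec:
  assumes "l \<le> n + 1"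
  shows skip_equal_ge: "l \<le> skip_equal I ord l"
    and skip_equal_le: "skip_equal I ord l \<le> n + 1"
    and skip_equal_deviation: "\<And>j. l \<le> j \<Longrightarrow> j \<le> skip_equal I ord l \<Longrightarrow> \<delta> j = \<delta> l"
proof -
  define P where "P x \<longleftrightarrow> l \<le> x \<and> x \<le> n + 1 \<and> (\<forall>j. l \<le> j \<longrightarrow> j \<le> x \<longrightarrow> \<delta> j = \<delta> l)" for x
  have "P (skip_equal I ord l)"
    unfolding skip_equal_def
  proof (rule while_rule[where P = P and r = "Wellfounded.measure (\<lambda>x. n + 1 - x)"])
    show "P l" unfolding P_def using assms by (metis order.refl le_antisym)
    fix x assume x: "P x" "x < n + 1 \<and> \<delta> x = \<delta> (x + 1)"
    then have "\<delta> (x + 1) = \<delta> l" unfolding P_def by (metis order.refl)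
    with x show "P (x + 1)" unfolding P_def by (metis Suc_eq_plus1 Suc_leI le_SucI le_Suc_eq)
    show "(x + 1, x) \<in> Wellfounded.measure (\<lambda>x. n + 1 - x)" using conjunct1[OF x(2)] by simp
  qed auto
  then show "l \<le> skip_equal I ord l" "skip_equal I ord l \<le> n + 1"
    and "\<And>j. l \<le> j \<Longrightarrow> j \<le> skip_equal I ord l \<Longrightarrow> \<delta> j = \<delta> l"
    unfolding P_def by blast+
qed

text \<open>The current index \<open>l\<close> is represented in \<open>L\<close> by an index of equal deviation, although \<open>l\<close> itself need not
  belong to \<open>L\<close> once the loop has ended by skipping. The size bound charges two positions to each
  index added, with one position of slack for a final step of length one.\<close>

definition index_invariant :: "nat \<times> nat set \<Rightarrow> bool" where
  "index_invariant = (\<lambda>(l, L). l \<in> {\<Gamma> + 1..n + 1} \<and> L \<subseteq> {1..n + 1} \<and> \<Gamma> + 1 \<in> L \<and>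
     (\<exists>k\<in>L. \<delta> k = \<delta> l) \<and>
     (\<forall>m\<in>{\<Gamma> + 1..<l}. \<exists>k\<in>L. \<delta> k = \<delta> m \<or> \<delta> k = \<delta> (m + 1)) \<and>
     2 * card L + \<Gamma> \<le> (if l < n + 1 then l + 1 else l + 2))"

lemma index_step_progress:
  assumes "l < n + 1"
  shows "l < fst (index_step I ord (l, L))"
  using skip_equal_ge[of l] assms by (auto simp: index_step_def Let_def)

lemma index_step_invariant:
  assumes inv: "index_invariant (l, L)" and l: "l < n + 1"
  shows "index_invariant (index_step I ord (l, L))"
proof -
  define l' where "l' = skip_equal I ord l"
  have l': "l \<le> l'" "l' \<le> n + 1" and eq: "\<And>j. l \<le> j \<Longrightarrow> j \<le> l' \<Longrightarrow> \<delta> j = \<delta> l"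
    unfolding l'_def using l by (intro skip_equal_spec; simp)+
  have L: "L \<subseteq> {1..n + 1}" "\<Gamma> + 1 \<in> L" "\<Gamma> + 1 \<le> l"
    and card: "2 * card L + \<Gamma> \<le> l + 1"
    and cover: "\<And>m. m \<in> {\<Gamma> + 1..<l} \<Longrightarrow> \<exists>k\<in>L. \<delta> k = \<delta> m \<or> \<delta> k = \<delta> (m + 1)"
    using inv l by (auto simp: index_invariant_def)
  obtain k where k: "k \<in> L" "\<delta> k = \<delta> l" using inv by (auto simp: index_invariant_def)
  \<comment> \<open>Positions passed over by skipping have the deviation of \<open>l\<close>, which \<open>L\<close> represents.\<close>
  have cover': "\<exists>k\<in>L. \<delta> k = \<delta> m \<or> \<delta> k = \<delta> (m + 1)" if "m \<in> {\<Gamma> + 1..l'}" for m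
    using cover[of m] k eq[of m] that by (cases "m < l") auto
  show ?thesis
  proof (cases "l' < n + 1")
    case False
    then have "index_step I ord (l, L) = (l', L)"
      by (simp add: index_step_def Let_def l'_def)
    moreover have "\<exists>k\<in>L. \<delta> k = \<delta> l'" using k eq[of l'] l' by auto
    ultimately show ?thesis
      using False L l' cover' card by (auto simp: index_invariant_def)
  next
    case True
    define l'' where "l'' = (if l' + 1 < n + 1 then l' + 2 else l' + 1)"
    have step: "index_step I ord (l, L) = (l'', insert l'' L)"
      using True by (simp add: index_step_def Let_def l'_def[symmetric] l''_def)
    have l'': "l' < l''" "l'' \<le> l' + 2" "l'' \<le> n + 1" "l'' < n + 1 \<Longrightarrow> l'' = l' + 2"
      using True by (auto simp: l''_def split: if_splits)
    have "\<exists>k\<in>insert l'' L. \<delta> k = \<delta> m \<or> \<delta> k = \<delta> (m + 1)" if "m \<in> {\<Gamma> + 1..<l''}" for m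
    proof (cases "m \<le> l'")
      case True
      then show ?thesis using cover'[of m] that by auto
    next
      case False
      \<comment> \<open>Only \<open>m = l' + 1\<close> is jumped over, and its successor \<open>l''\<close> is the index just added.\<close>
      then have "m + 1 = l''" using that l'' by auto
      then show ?thesis by auto
    qed
    moreover have "2 * card (insert l'' L) + \<Gamma> \<le> (if l'' < n + 1 then l'' + 1 else l'' + 2)"
      using card l' l'' card_insert_le_m1[of "card L + 1" L l''] by auto
    ultimately show ?thesis
      unfolding step index_invariant_def using L l' l'' by auto
  qed
qed

lemma reduced_index_set_spec:
  shows "hits_every_exact_interval (reduced_index_set I i1 ord)"
    and "2 * card (reduced_index_set I i1 ord) + \<Gamma> \<le> n + 3"
proof -
  let ?s = "while (\<lambda>(l, L). l < card (ground I) + 1) (index_step I ord) (\<Gamma> + 1, {\<Gamma> + 1})"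
  have "index_invariant ?s \<and> \<not> fst ?s < n + 1"
  proof (rule while_rule[where P = index_invariant and r = "Wellfounded.measure (\<lambda>s. n + 1 - fst s)"])
    show "index_invariant (\<Gamma> + 1, {\<Gamma> + 1})"
      using budget_le by (auto simp: index_invariant_def)
  next
    fix s assume "index_invariant s" "case s of (l, L) \<Rightarrow> l < n + 1"
    then show "index_invariant (index_step I ord s)"
      using index_step_invariant by (cases s) auto
  next
    fix s assume "index_invariant s" "case s of (l, L) \<Rightarrow> l < n + 1"
    then show "(index_step I ord s, s) \<in> Wellfounded.measure (\<lambda>s. n + 1 - fst s)"
      using index_step_progress[of "fst s" "snd s"] by (cases s) auto
  qed auto
  moreover obtain l L where s': "?s = (l, L)" by (cases ?s)
  ultimately have inv': "index_invariant (l, L)" and "\<not> l < n + 1" by simp_all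
  then have "l = n + 1" by (simp add: index_invariant_def)
  with s' inv' have s: "?s = (n + 1, L)" and inv: "index_invariant (n + 1, L)" by simp_all
  have L: "reduced_index_set I i1 ord = L"
    unfolding reduced_index_set_def s by simp
  have "\<delta> (n + 1) = 0" by (simp add: sorted_deviation_def)
  then show "hits_every_exact_interval (reduced_index_set I i1 ord)"
    using inv unfolding L
    by (auto simp: index_invariant_def hits_every_exact_interval_def)
  show "2 * card (reduced_index_set I i1 ord) + \<Gamma> \<le> n + 3"
    using inv unfolding L by (auto simp: index_invariant_def)
qed

section \<open>The solving phase and correctness\<close>

lemma solve_phase_count: "solve_phase I ord prev ls A k \<Longrightarrow> k \<le> length ls"
  by (induction rule: solve_phase.induct) auto

lemma solve_phase_ex: "\<exists>A k. solve_phase I ord prev ls A k"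
proof (induction ls arbitrary: prev)
  case (Cons l ls)
  obtain OPT where OPT: "complete_efficient_set (feasible I) (g l) OPT"
    using ex_complete_efficient_set[OF finite_feasible] by blast
  show ?case
  proof (cases "must_solve ord prev l")
    case True
    then show ?thesis using Cons[of "Some OPT"] OPT by (blast intro: solve_phase.solved)
  next
    case False
    then obtain P where "prev = Some P" by (cases prev) (auto simp: must_solve_def)
    with False Cons[of "Some P"] show ?thesis by (blast intro: solve_phase.reused)
  qed
qed (blast intro: solve_phase.finished)

text \<open>The index \<open>p\<close> that \<open>prev\<close> covers is the one directly preceding the list. A reused set covers its new
  index as well, so chains of skipped subproblems need no separate treatment.\<close>

lemma solve_phase_covers:
  assumes "solve_phase I ord prev ls A k"
    and "sorted_wrt (<) ls" and "\<forall>l\<in>set ls. 1 \<le> l"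
    and "\<And>P. prev = Some P \<Longrightarrow>
      \<exists>p\<ge>1. weakly_covers (feasible I) (g p) P \<and> (\<forall>l\<in>set ls. p < l)"
  shows "A \<subseteq> feasible I \<and> (\<forall>l\<in>set ls. weakly_covers (feasible I) (g l) A)"
  using assms
proof (induction rule: solve_phase.induct)
  case (solved prev l OPT ls A k)
  have OPT: "weakly_covers (feasible I) (g l) OPT"
    using solved by (intro complete_efficient_set_imp_weakly_covers)
  have "A \<subseteq> feasible I \<and> (\<forall>l\<in>set ls. weakly_covers (feasible I) (g l) A)"
    using solved OPT by (intro solved.IH) auto
  with OPT show ?case by (auto simp: weakly_covers_def) (blast)+
next
  case (reused OPT l ls A k)
  obtain p where "1 \<le> p" "weakly_covers (feasible I) (g p) OPT" "p < l"
    using reused.prems(3)[of OPT] by auto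
  then have OPT: "weakly_covers (feasible I) (g l) OPT"
    using weakly_covers_if_avoids reused.hyps by blast
  have "A \<subseteq> feasible I \<and> (\<forall>l\<in>set ls. weakly_covers (feasible I) (g l) A)"
    using reused OPT by (intro reused.IH) auto
  with OPT show ?case by (auto simp: weakly_covers_def) (blast)+
qed auto

text \<open>At an index \<open>l\<close> where \<open>q\<close> is exact, any \<open>q'\<close> with \<open>g l q' \<le> g l q\<close> satisfies
  \<open>z q' \<le> g l q' \<le> g l q = z q\<close> for the robust cost \<open>z\<close>, whether or not \<open>q'\<close> is exact at \<open>l\<close>.\<close>

lemma weakly_covers_robust_cost:
  assumes L: "hits_every_exact_interval L" and A: "A \<subseteq> feasible I"
    and cov: "\<And>l. l \<in> L \<Longrightarrow> weakly_covers (feasible I) (g l) A"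
  shows "weakly_covers (feasible I) (robust_cost I) A"
  unfolding weakly_covers_def
proof (intro conjI ballI A)
  fix q assume q: "q \<in> feasible I"
  obtain l where "l \<in> L" and ex: "exact q l" using ex_exact_index[OF q L] by blast
  with cov q obtain q' where "q' \<in> A" "g l q' \<le> g l q"
    unfolding weakly_covers_def by blast
  moreover have "robust_cost I q' \<le> g l q'"
    using \<open>q' \<in> A\<close> A ex by (intro robust_cost_le_subproblem_cost) (auto simp: exact_def)
  ultimately show "\<exists>q'\<in>A. robust_cost I q' \<le> robust_cost I q"
    using robust_cost_exact[OF q ex] by (auto intro: order_trans)
qed

lemma improved_DSA_oi_ex: "\<exists>result k. improved_DSA_oi I i1 ord result k"
  using solve_phase_ex unfolding improved_DSA_oi_def by blast

lemma improved_DSA_oi_correct: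
  assumes "improved_DSA_oi I i1 ord result k"
  shows "complete_efficient_set (feasible I) (robust_cost I) result"
    and "2 * k + \<Gamma> \<le> n + 3"
proof -
  let ?L = "reduced_index_set I i1 ord"
  obtain A where A: "solve_phase I ord None (sorted_list_of_set ?L) A k"
    and res: "result = {q \<in> A. \<not> (\<exists>q'\<in>A. dominates (robust_cost I q') (robust_cost I q))}"
    using assms unfolding improved_DSA_oi_def by blast
  have L: "?L \<subseteq> {1..n + 1}"
    using reduced_index_set_spec(1) by (simp add: hits_every_exact_interval_def)
  then have "finite ?L" by (rule finite_subset) simp
  have "1 \<le> l" if "l \<in> ?L" for l using L that by auto
  with \<open>finite ?L\<close> have "A \<subseteq> feasible I \<and> (\<forall>l\<in>?L. weakly_covers (feasible I) (g l) A)"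
    using solve_phase_covers[OF A] by auto
  then have "weakly_covers (feasible I) (robust_cost I) A"
    using weakly_covers_robust_cost[OF reduced_index_set_spec(1)] by blast
  then show "complete_efficient_set (feasible I) (robust_cost I) result"
    unfolding res by (rule complete_efficient_set_nondominated[OF finite_feasible])
  show "2 * k + \<Gamma> \<le> n + 3"
    using solve_phase_count[OF A] reduced_index_set_spec(2) by simp
qed

end

theorem corollary19:
  fixes I :: "('e, 'k::finite) uncertain_instance"
    and ord :: "nat \<Rightarrow> 'e"
    and i1 :: 'k
  assumes "valid_instance I"
    and "objective_independent_order I ord"
  shows "(\<exists>result n. improved_DSA_oi I i1 ord result n) \<and>
    (\<forall>result n. improved_DSA_oi I i1 ord result n \<longrightarrow>
       complete_efficient_set (feasible I) (robust_cost I) result \<and>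
       int n \<le> \<lceil>(real (card (ground I)) - real (budget I $ i1)) / 2\<rceil> + 1)"
proof -
  interpret ordered_instance I ord i1 using assms by unfold_locales
  have "int k \<le> \<lceil>(real (card (ground I)) - real (budget I $ i1)) / 2\<rceil> + 1"
    if "2 * k + budget I $ i1 \<le> card (ground I) + 3" for k
    using that unfolding diff_le_eq[symmetric] le_ceiling_iff by simp
  with improved_DSA_oi_ex improved_DSA_oi_correct show ?thesis by blast
qed

end
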